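(* Let $G=(D\cup I,E)$ be a split graph and let $k=\chi_p^2(H(G))$. Then $G$ does not have $k+2$ completely independent spanning trees.
   Context: A split graph $G=(D\cup I,E)$ is a graph whose vertex set is partitioned into a clique $D$ and an independent set $I$; the paper assumes throughout that every vertex of $D$ is adjacent to at least one vertex of $I$. Its corresponding hypergraph is $H(G)=(D,\mathcal{E})$ with $\mathcal{E}=\{N_G(x) : x\in I\}$ (one hyperedge for each $x\in I$). A panchromatic $k$-coloring of a hypergraph is an assignment of colors from $\{1,\dots,k\}$ to its vertices such that every hyperedge contains at least one vertex of each of the $k$ colors; it is bipanchromatic if each of the $k$ colors is assigned to at least two vertices. The bipanchromatic number $\chi_p^2(H)$ is the maximum $k$ such that $H$ admits a bipanchromatic $k$-coloring. Spanning trees $T_1,\dots,T_m$ of a graph are completely independent spanning trees if for every pair of vertices $x,y$ the $(x,y)$-paths in $T_1,\dots,T_m$ are pairwise edge-disjoint and have no common internal vertex. *)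

theory Defs
  imports "Graph_Theory.Graph_Theory" "HOL-Library.Multiset"
begin

text \<open>
  Finite simple graphs are the symmetric loop-free pair digraphs (locale \<open>pair_graph\<close>): an
  undirected edge \<open>uv\<close> is the pair of arcs \<open>(u, v)\<close> and \<open>(v, u)\<close>.
\<close>

definition neighbourhood :: "'a pair_pre_digraph \<Rightarrow> 'a \<Rightarrow> 'a set" where
  "neighbourhood G x = {y. (x, y) \<in> parcs G}"

definition split_graph :: "'a pair_pre_digraph \<Rightarrow> 'a set \<Rightarrow> 'a set \<Rightarrow> bool" where
  "split_graph G D I \<longleftrightarrow>
     pair_graph G \<and> pverts G = D \<union> I \<and> D \<inter> I = {} \<and>
     (\<forall>u\<in>D. \<forall>v\<in>D. u \<noteq> v \<longrightarrow> (u, v) \<in> parcs G) \<and>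
     (\<forall>u\<in>I. \<forall>v\<in>I. (u, v) \<notin> parcs G)"

text \<open>
  Hyperedges form a multiset, since different vertices of the independent set may have the same
  neighbourhood.
\<close>

record 'a hypergraph =
  hverts :: "'a set"
  hedges :: "'a set multiset"

definition split_hypergraph :: "'a pair_pre_digraph \<Rightarrow> 'a set \<Rightarrow> 'a set \<Rightarrow> 'a hypergraph" where
  "split_hypergraph G D I =
     \<lparr>hverts = D, hedges = image_mset (neighbourhood G) (mset_set I)\<rparr>"

definition panchromatic_coloring :: "'a hypergraph \<Rightarrow> nat \<Rightarrow> ('a \<Rightarrow> nat) \<Rightarrow> bool" where
  "panchromatic_coloring H k c \<longleftrightarrow>
     c ` hverts H \<subseteq> {1..k} \<and> (\<forall>e\<in>#hedges H. \<forall>i\<in>{1..k}. \<exists>v\<in>e. c v = i)"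

definition bipanchromatic_coloring :: "'a hypergraph \<Rightarrow> nat \<Rightarrow> ('a \<Rightarrow> nat) \<Rightarrow> bool" where
  "bipanchromatic_coloring H k c \<longleftrightarrow>
     panchromatic_coloring H k c \<and> (\<forall>i\<in>{1..k}. 2 \<le> card {v \<in> hverts H. c v = i})"

text \<open>
  On the naturals \<open>Sup\<close> of a nonempty finite set is its maximum, and \<open>Sup {} = 0\<close>: the number is 0
  for a hypergraph without any bipanchromatic coloring (for example, with a single vertex).
\<close>

definition bipanchromatic_number :: "'a hypergraph \<Rightarrow> nat" where
  "bipanchromatic_number H = Sup {k. \<exists>c. bipanchromatic_coloring H k c}"

lemma bipanchromatic_coloring_le_card:
  assumes "finite (hverts H)" "bipanchromatic_coloring H k c"
  shows "k \<le> card (hverts H)"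
proof -
  have "{1..k} \<subseteq> c ` hverts H"
  proof
    fix i assume "i \<in> {1..k}"
    then have "2 \<le> card {v \<in> hverts H. c v = i}"
      using assms(2) by (simp add: bipanchromatic_coloring_def)
    then have "{v \<in> hverts H. c v = i} \<noteq> {}"
      by (metis card.empty not_numeral_le_zero)
    then show "i \<in> c ` hverts H" by auto
  qed
  then have "card {1..k} \<le> card (hverts H)"
    using assms(1) by (meson surj_card_le)
  then show ?thesis by simp
qed

lemma bipanchromatic_number_is_maximum:
  assumes fin: "finite (hverts H)" and ex: "bipanchromatic_coloring H k c"
  shows "\<exists>c'. bipanchromatic_coloring H (bipanchromatic_number H) c'"
    and "k \<le> bipanchromatic_number H"
proof -
  let ?K = "{k. \<exists>c. bipanchromatic_coloring H k c}"
  have "?K \<subseteq> {..card (hverts H)}"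
    using bipanchromatic_coloring_le_card[OF fin] by auto
  then have K: "finite ?K" by (rule finite_subset) simp
  have ne: "k \<in> ?K" using ex by auto
  then have eq: "bipanchromatic_number H = Max ?K"
    unfolding bipanchromatic_number_def using K by (subst cSup_eq_Max) auto
  show "\<exists>c'. bipanchromatic_coloring H (bipanchromatic_number H) c'"
    using Max_in[OF K] ne unfolding eq by blast
  show "k \<le> bipanchromatic_number H"
    unfolding eq using K ne by (rule Max_ge)
qed

text \<open>
  The library's \<open>tree\<close> is not suitable here: it forbids directed cycles only, so it rejects every
  symmetric digraph with an edge (\<open>u, v, u\<close> is a directed cycle) and accepts acyclic orientations
  of undirected cycles. In a symmetric loop-free pair digraph, the cycles of the undirected graph
  are exactly the directed cycles of length at least 3.
\<close>

definition undirected_tree :: "'a pair_pre_digraph \<Rightarrow> bool" where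
  "undirected_tree T \<longleftrightarrow>
     pair_graph T \<and> Digraph_Component.connected (with_proj T) \<and>
     \<not> (\<exists>p. pre_digraph.cycle (with_proj T) p \<and> 3 \<le> length p)"

definition undirected_spanning_tree :: "'a pair_pre_digraph \<Rightarrow> 'a pair_pre_digraph \<Rightarrow> bool" where
  "undirected_spanning_tree T G \<longleftrightarrow>
     undirected_tree T \<and> spanning (with_proj T) (with_proj G)"

definition undirected_edges :: "('a \<times> 'a) awalk \<Rightarrow> 'a set set" where
  "undirected_edges p = (\<lambda>(u, v). {u, v}) ` set p"

definition completely_independent_spanning_trees ::
    "'a pair_pre_digraph \<Rightarrow> 'a pair_pre_digraph list \<Rightarrow> bool" where
  "completely_independent_spanning_trees G Ts \<longleftrightarrow>
     (\<forall>T\<in>set Ts. undirected_spanning_tree T G) \<and>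
     (\<forall>x\<in>pverts G. \<forall>y\<in>pverts G. \<forall>i<length Ts. \<forall>j<length Ts. i \<noteq> j \<longrightarrow>
        (\<forall>p q. pre_digraph.apath (with_proj (Ts ! i)) x p y \<and>
               pre_digraph.apath (with_proj (Ts ! j)) x q y \<longrightarrow>
           undirected_edges p \<inter> undirected_edges q = {} \<and>
           set (pre_digraph.inner_verts (with_proj (Ts ! i)) p) \<inter>
           set (pre_digraph.inner_verts (with_proj (Ts ! j)) q) = {}))"

end

theory Submission
  imports Defs
begin

text \<open>
  Call a vertex internal in a tree if its degree there is at least 2, and let \<open>V\<^sub>i\<close> be the set of
  internal vertices of the \<open>i\<close>-th tree. These sets are pairwise disjoint, and every vertex has a
  tree neighbour in \<open>V\<^sub>i\<close> unless it is the only element of \<open>V\<^sub>i\<close>. Neighbours of \<open>I\<close> lie in \<open>D\<close>, so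
  each \<open>V\<^sub>i \<inter> D\<close> with at least two elements meets every hyperedge and can serve as a color class.
  If \<open>V\<^sub>i \<inter> D\<close> has at most one element, then \<open>V\<^sub>i\<close> has a center adjacent in the \<open>i\<close>-th tree to all
  other vertices of \<open>I\<close>; two such trees would share the edge between their centers. Hence
  \<open>k + 2\<close> trees yield a bipanchromatic coloring with \<open>k + 1\<close> colors.
\<close>

section \<open>Internal vertices and separation in one tree\<close>

definition internal_vertices :: "'a pair_pre_digraph \<Rightarrow> 'a set" where
  "internal_vertices T = {v. \<exists>u w. u \<noteq> w \<and> (u, v) \<in> parcs T \<and> (v, w) \<in> parcs T}"

text \<open>For vertices other than \<open>v\<close>, this is lying in the same component once
  \<open>v\<close> is deleted. Walks instead of paths make transitivity plain concatenation.\<close>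

definition linked_avoiding :: "'a pair_pre_digraph \<Rightarrow> 'a \<Rightarrow> 'a \<Rightarrow> 'a \<Rightarrow> bool" where
  "linked_avoiding T v a b \<longleftrightarrow>
     (\<exists>p. pre_digraph.awalk (with_proj T) a p b \<and> v \<notin> set (pawalk_verts a p))"

context pair_graph
begin

lemma linked_avoiding_sym: "linked_avoiding G v a b \<Longrightarrow> linked_avoiding G v b a"
  unfolding linked_avoiding_def by (metis awalk_rev_path awalk_verts_rev_path awalkE set_rev)

lemma linked_avoiding_trans:
  assumes "linked_avoiding G v a b" "linked_avoiding G v b c"
  shows "linked_avoiding G v a c"
proof -
  obtain p q where "awalk a p b" "v \<notin> set (pawalk_verts a p)"
    "awalk b q c" "v \<notin> set (pawalk_verts b q)"
    using assms unfolding linked_avoiding_def by auto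
  then have "awalk a (p @ q) c" "v \<notin> set (pawalk_verts a (p @ q))"
    using set_awalk_verts_append[of a p b q c] by auto
  then show ?thesis unfolding linked_avoiding_def by blast
qed

lemma connected_obtains_apath:
  assumes "connected G" "x \<in> pverts G" "y \<in> pverts G"
  obtains p where "apath x p y"
proof -
  have "strongly_connected G"
    using symmetric_connected_imp_strongly_connected assms(1) pair_sym_arcs by blast
  then have "x \<rightarrow>\<^sup>*\<^bsub>G\<^esub> y"
    using assms(2,3) by (auto simp: strongly_connected_def)
  then show ?thesis using that by (auto simp: reachable_apath)
qed

text \<open>The second vertex of a path from \<open>x\<close> to \<open>y\<close> serves as
  \<open>z\<close>. Unless the path ends there, its next vertex differs from \<open>x\<close>, so
  \<open>z\<close> has two distinct neighbours.\<close>

lemma neighbour_towards: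
  assumes "connected G" "x \<in> pverts G" "y \<in> pverts G" "x \<noteq> y"
  obtains z where "(x, z) \<in> parcs G" "z = y \<or> z \<in> internal_vertices G"
proof -
  obtain p where p: "apath x p y"
    using connected_obtains_apath assms(1-3) by blast
  then obtain e q where pq: "p = e # q"
    using assms(4) by (cases p) (auto simp: apath_Nil_iff)
  obtain z where e: "e = (x, z)" and xz: "(x, z) \<in> parcs G" and q: "apath z q y"
    and nx: "x \<notin> set (pawalk_verts z q)"
    using p unfolding pq by (cases e) (auto simp: apath_Cons_iff)
  show ?thesis
  proof (cases q)
    case Nil
    then have "z = y" using q by (simp add: apath_Nil_iff)
    then show ?thesis using that xz by blast
  next
    case (Cons f r)
    obtain w where "f = (z, w)" "(z, w) \<in> parcs G" "apath w r y"
      using q unfolding Cons by (cases f) (auto simp: apath_Cons_iff)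
    moreover then have "x \<noteq> w"
      using nx Cons by (cases r) (auto simp: apath_Cons_iff)
    ultimately have "z \<in> internal_vertices G"
      using xz unfolding internal_vertices_def by blast
    then show ?thesis using that xz by blast
  qed
qed

lemma internal_vertices_subset: "internal_vertices G \<subseteq> pverts G"
  unfolding internal_vertices_def using in_arcsD1 by auto

text \<open>Without internal vertices, \<open>neighbour_towards\<close> would make any two distinct
  vertices adjacent, and among three vertices one would be internal after all.\<close>

lemma internal_vertices_nonempty:
  assumes "connected G" "3 \<le> card (pverts G)"
  shows "internal_vertices G \<noteq> {}"
proof
  assume e: "internal_vertices G = {}"
  obtain x y z where "x \<in> pverts G" "y \<in> pverts G" "z \<in> pverts G" "x \<noteq> y" "y \<noteq> z" "x \<noteq> z"
    using assms(2) by (metis card_3_iff insert_subset obtain_subset_with_card_n)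
  then have "(x, y) \<in> parcs G" "(y, z) \<in> parcs G"
    using e neighbour_towards[OF assms(1)] by (metis empty_iff)+
  then show False using e \<open>x \<noteq> z\<close> unfolding internal_vertices_def by blast
qed

lemma not_linked_avoiding_imp_inner:
  assumes "apath x p y" "x \<noteq> v" "y \<noteq> v" "\<not> linked_avoiding G v x y"
  shows "v \<in> set (inner_verts p)"
proof -
  have "awalk x p y" using assms(1) by (simp add: apath_def)
  then have "v \<in> set (pawalk_verts x p)"
    using assms(4) unfolding linked_avoiding_def by blast
  then show ?thesis using set_inner_verts[OF assms(1)] assms(2,3) by auto
qed

text \<open>A walk avoiding \<open>v\<close> between two neighbours of \<open>v\<close> would close
  up through \<open>v\<close> to a cycle.\<close>

lemma internal_vertex_separates:
  assumes "v \<in> internal_vertices G" and "\<not> (\<exists>p. cycle p \<and> 3 \<le> length p)"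
  obtains u w where "u \<in> pverts G - {v}" "w \<in> pverts G - {v}" "\<not> linked_avoiding G v u w"
proof -
  obtain u w where uw: "u \<noteq> w" "(u, v) \<in> parcs G" "(v, w) \<in> parcs G"
    using assms(1) unfolding internal_vertices_def by blast
  have "\<not> linked_avoiding G v w u"
  proof
    assume "linked_avoiding G v w u"
    then obtain p where p: "awalk w p u" "v \<notin> set (pawalk_verts w p)"
      unfolding linked_avoiding_def by blast
    \<comment> \<open>A cycle must not repeat vertices, so the walk is shortened to a path; its arcs
      come from \<open>p\<close>, so it still avoids \<open>v\<close>.\<close>
    define q where "q = awalk_to_apath p"
    have q: "apath w q u" unfolding q_def using apath_awalk_to_apath p(1) by blast
    have q': "awalk w q u" "distinct (pawalk_verts w q)" using q by (auto simp: apath_def)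
    have "set q \<subseteq> set p" unfolding q_def using awalk_to_apath_subset p(1) by blast
    then have "v \<notin> set (pawalk_verts w q)"
      using p(2) set_awalk_verts[OF p(1)] set_awalk_verts[OF q'(1)] by auto
    \<comment> \<open>As \<open>u\<close> and \<open>w\<close> differ, the path has an arc. With the
      two arcs at \<open>v\<close> this makes length at least 3, more than going back and forth
      along one edge.\<close>
    moreover have "q \<noteq> []" using q uw(1) by (auto simp: apath_Nil_iff)
    moreover have C: "awalk v ((v, w) # q @ [(u, v)]) v"
      using q'(1) uw by (auto simp: awalk_Cons_iff awalk_Nil_iff in_arcsD1 in_arcsD2)
    moreover have "pawalk_verts w (q @ [(u, v)]) = pawalk_verts w q @ [v]"
      using C awalk_verts_append[of w q "[(u, v)]" v] by (auto simp: awalk_Cons_iff)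
    ultimately have "cycle ((v, w) # q @ [(u, v)])" "3 \<le> length ((v, w) # q @ [(u, v)])"
      using q'(2) unfolding cycle_def
      by (auto intro!: exI[of _ v] simp: Suc_le_eq)
    then show False using assms(2) by blast
  qed
  moreover have "u \<noteq> v" "w \<noteq> v" using uw no_loops' by blast+
  ultimately show ?thesis using that in_arcsD1 in_arcsD2 uw by blast
qed

end

text \<open>Compare: no group is the union of two proper subgroups. If \<open>R a b\<close> fails,
  then \<open>S a b\<close>, and every \<open>z\<close> is \<open>S\<close>-related to
  \<open>a\<close>, directly or through \<open>b\<close>.\<close>

lemma equivalences_cover_imp_total:
  assumes "\<And>a b. R a b \<Longrightarrow> R b a" "\<And>a b c. R a b \<Longrightarrow> R b c \<Longrightarrow> R a c"
    and "\<And>a b. S a b \<Longrightarrow> S b a" "\<And>a b c. S a b \<Longrightarrow> S b c \<Longrightarrow> S a c"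
    and "\<And>a b. a \<in> X \<Longrightarrow> b \<in> X \<Longrightarrow> R a b \<or> S a b"
  shows "(\<forall>a\<in>X. \<forall>b\<in>X. R a b) \<or> (\<forall>a\<in>X. \<forall>b\<in>X. S a b)"
proof (rule ccontr)
  assume "\<not> ?thesis"
  then obtain a b c d where ab: "a \<in> X" "b \<in> X" "\<not> R a b" and cd: "c \<in> X" "d \<in> X" "\<not> S c d"
    by blast
  have "S a z" if "z \<in> X" for z
    using ab that assms by metis
  then show False using cd assms(3,4) by blast
qed

section \<open>Disjoint edges and disjoint internal vertices of independent trees\<close>

lemma undirected_spanning_treeD:
  assumes "undirected_spanning_tree T G"
  shows "pair_graph T" "Digraph_Component.connected (with_proj T)"
    "\<not> (\<exists>p. pre_digraph.cycle (with_proj T) p \<and> 3 \<le> length p)"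
    "pverts T = pverts G" "parcs T \<subseteq> parcs G"
  using assms
  by (auto simp: undirected_spanning_tree_def undirected_tree_def spanning_def subgraph_def)

locale independent_trees =
  fixes G :: "'a pair_pre_digraph" and Ts :: "'a pair_pre_digraph list"
  assumes cist: "completely_independent_spanning_trees G Ts"
begin

lemma spanning_tree: "i < length Ts \<Longrightarrow> undirected_spanning_tree (Ts ! i) G"
  using cist by (auto simp: completely_independent_spanning_trees_def)

lemmas tree_pair_graph = undirected_spanning_treeD(1)[OF spanning_tree]
  and tree_connected = undirected_spanning_treeD(2)[OF spanning_tree]
  and tree_acyclic = undirected_spanning_treeD(3)[OF spanning_tree]
  and tree_verts = undirected_spanning_treeD(4)[OF spanning_tree]
  and tree_arcs = undirected_spanning_treeD(5)[OF spanning_tree]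

lemma tree_arc_sym: "i < length Ts \<Longrightarrow> (u, v) \<in> parcs (Ts ! i) \<Longrightarrow> (v, u) \<in> parcs (Ts ! i)"
  using tree_pair_graph pair_sym_digraph.arcs_symmetric
  by (metis pair_graph_def pair_pseudo_graph_def)

lemma independent:
  assumes "i < length Ts" "j < length Ts" "i \<noteq> j"
    and "pre_digraph.apath (with_proj (Ts ! i)) x p y"
    and "pre_digraph.apath (with_proj (Ts ! j)) x q y"
  shows "undirected_edges p \<inter> undirected_edges q = {}"
    and "set (pre_digraph.inner_verts (with_proj (Ts ! i)) p) \<inter>
         set (pre_digraph.inner_verts (with_proj (Ts ! j)) q) = {}"
proof -
  interpret pair_graph "Ts ! i" using tree_pair_graph assms(1) .
  have "x \<in> pverts G" "y \<in> pverts G"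
    using assms(4) tree_verts[OF assms(1)]
    by (auto simp: apath_def dest: awalk_hd_in_verts awalk_last_in_verts)
  then show "undirected_edges p \<inter> undirected_edges q = {}"
    and "set (pre_digraph.inner_verts (with_proj (Ts ! i)) p) \<inter>
         set (pre_digraph.inner_verts (with_proj (Ts ! j)) q) = {}"
    using cist assms unfolding completely_independent_spanning_trees_def by blast+
qed

text \<open>A shared arc would by itself be a path between its ends in both trees, against
  edge-disjointness.\<close>

lemma arcs_disjoint:
  assumes "i < length Ts" "j < length Ts" "i \<noteq> j"
    and "(u, v) \<in> parcs (Ts ! i)"
  shows "(u, v) \<notin> parcs (Ts ! j)"
proof
  assume uv: "(u, v) \<in> parcs (Ts ! j)"
  interpret S: pair_graph "Ts ! i" using tree_pair_graph assms(1) .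
  interpret T: pair_graph "Ts ! j" using tree_pair_graph assms(2) .
  have "u \<noteq> v" using S.no_loops' assms(4) by blast
  then have "S.apath u [(u, v)] v" "T.apath u [(u, v)] v"
    using uv assms(4)
    by (auto simp: S.apath_Cons_iff T.apath_Cons_iff S.apath_Nil_iff T.apath_Nil_iff
        S.in_arcsD2 T.in_arcsD2)
  from independent(1)[OF assms(1-3) this] show False
    by (simp add: undirected_edges_def)
qed

text \<open>
  If \<open>v\<close> were internal in two trees, then in neither tree would all other vertices be linked
  avoiding \<open>v\<close>, so some pair would be separated by \<open>v\<close> in both.
\<close>

lemma internal_vertices_disjoint:
  assumes "i < length Ts" "j < length Ts" "i \<noteq> j"
  shows "internal_vertices (Ts ! i) \<inter> internal_vertices (Ts ! j) = {}"
proof (rule ccontr)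
  interpret S: pair_graph "Ts ! i" using tree_pair_graph assms(1) .
  interpret T: pair_graph "Ts ! j" using tree_pair_graph assms(2) .
  assume "\<not> ?thesis"
  then obtain v where v: "v \<in> internal_vertices (Ts ! i)" "v \<in> internal_vertices (Ts ! j)"
    by blast
  let ?X = "pverts G - {v}"
  have "\<not> (\<forall>x\<in>?X. \<forall>y\<in>?X. linked_avoiding (Ts ! i) v x y)"
    using S.internal_vertex_separates[OF v(1) tree_acyclic[OF assms(1)]]
    unfolding tree_verts[OF assms(1)] by blast
  moreover have "\<not> (\<forall>x\<in>?X. \<forall>y\<in>?X. linked_avoiding (Ts ! j) v x y)"
    using T.internal_vertex_separates[OF v(2) tree_acyclic[OF assms(2)]]
    unfolding tree_verts[OF assms(2)] by blast
  ultimately obtain x y where xy: "x \<in> ?X" "y \<in> ?X"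
    "\<not> linked_avoiding (Ts ! i) v x y" "\<not> linked_avoiding (Ts ! j) v x y"
    using equivalences_cover_imp_total[of "linked_avoiding (Ts ! i) v"
        "linked_avoiding (Ts ! j) v" ?X]
      S.linked_avoiding_sym T.linked_avoiding_sym S.linked_avoiding_trans T.linked_avoiding_trans
    by metis
  obtain p where p: "S.apath x p y"
    using S.connected_obtains_apath tree_connected tree_verts assms(1) xy by (metis DiffD1)
  obtain q where q: "T.apath x q y"
    using T.connected_obtains_apath tree_connected tree_verts assms(2) xy by (metis DiffD1)
  have "v \<in> set (S.inner_verts p)" "v \<in> set (T.inner_verts q)"
    using S.not_linked_avoiding_imp_inner[OF p] T.not_linked_avoiding_imp_inner[OF q] xy by blast+
  then show False using independent(2)[OF assms p q] by blast
qed

lemma internal_vertices_verts: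
  "i < length Ts \<Longrightarrow> internal_vertices (Ts ! i) \<subseteq> pverts G"
  using pair_graph.internal_vertices_subset tree_pair_graph tree_verts by metis

text \<open>Both outcomes of \<open>neighbour_towards\<close> are internal, since \<open>y\<close>
  itself is.\<close>

lemma internal_neighbour:
  assumes "i < length Ts" "x \<in> pverts G" "y \<in> internal_vertices (Ts ! i)" "x \<noteq> y"
  obtains z where "z \<in> internal_vertices (Ts ! i)" "(x, z) \<in> parcs (Ts ! i)"
  using pair_graph.neighbour_towards[OF tree_pair_graph tree_connected, of i x y]
    tree_verts[of i] internal_vertices_verts[of i] assms by (metis subsetD)

end

section \<open>Small and large classes in a split graph\<close>

locale split_independent_trees = independent_trees +
  fixes D I :: "'a set"
  assumes split: "split_graph G D I"
    and two_trees: "2 \<le> length Ts"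
    and not_single: "card (pverts G) \<noteq> 1"
begin

lemma finite_verts: "finite (pverts G)"
  and verts_eq: "pverts G = D \<union> I" and D_I_disjoint: "D \<inter> I = {}"
  using split pair_fin_digraph.pair_finite_verts
  unfolding split_graph_def pair_graph_def pair_pseudo_graph_def by blast+

lemma neighbour_of_independent:
  assumes "x \<in> I" "(x, z) \<in> parcs G"
  shows "z \<in> D"
proof -
  have "z \<in> pverts G"
    using assms(2) split pair_wf_digraph.in_arcsD2
    unfolding split_graph_def pair_graph_def pair_pseudo_graph_def pair_fin_digraph_def by metis
  then show ?thesis using assms split unfolding split_graph_def by blast
qed

text \<open>On two vertices the trees would share the only edge. A single vertex has to be excluded
  by assumption: there any number of edgeless trees is completely independent.\<close>

lemma card_verts: "3 \<le> card (pverts G)"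
proof -
  have zero: "0 < length Ts" using two_trees by linarith
  have ne: "pverts G \<noteq> {}"
    using tree_connected[OF zero] tree_verts[OF zero]
    by (auto simp: connected_def strongly_connected_def mk_symmetric_def)
  have "card (pverts G) \<noteq> 2"
  proof
    assume "card (pverts G) = 2"
    then obtain x y where xy: "pverts G = {x, y}" "x \<noteq> y" by (auto simp: card_2_iff)
    have "(x, y) \<in> parcs (Ts ! i)" if i: "i < length Ts" for i
    proof -
      interpret pair_graph "Ts ! i" using tree_pair_graph i .
      obtain z where z: "(x, z) \<in> parcs (Ts ! i)"
        using neighbour_towards[OF tree_connected[OF i], of x y]
        unfolding tree_verts[OF i] using xy by blast
      have "z \<in> {x, y}" using in_arcsD2[OF z] tree_verts[OF i] xy(1) by simp
      moreover have "x \<noteq> z" using no_loops' z by blast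
      ultimately show ?thesis using z by auto
    qed
    moreover have "1 < length Ts" using two_trees by linarith
    ultimately show False using arcs_disjoint[OF zero, of 1 x y] zero by simp
  qed
  moreover have "card (pverts G) \<noteq> 0" using finite_verts ne by simp
  ultimately show ?thesis using not_single by linarith
qed

lemma class_nonempty: "i < length Ts \<Longrightarrow> internal_vertices (Ts ! i) \<noteq> {}"
  using pair_graph.internal_vertices_nonempty[OF tree_pair_graph tree_connected, of i]
    card_verts tree_verts[of i] by simp

text \<open>A vertex of \<open>I\<close> other than \<open>c\<close> has a tree neighbour in the
  class. This neighbour lies in \<open>D\<close>, where the class has no element besides
  \<open>c\<close>.\<close>

lemma small_class_center:
  assumes i: "i < length Ts" and small: "card (internal_vertices (Ts ! i) \<inter> D) \<le> 1"
  obtains c where "c \<in> internal_vertices (Ts ! i)" "internal_vertices (Ts ! i) \<subseteq> insert c I"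
    "\<And>x. x \<in> I \<Longrightarrow> x \<noteq> c \<Longrightarrow> (x, c) \<in> parcs (Ts ! i)"
proof -
  let ?V = "internal_vertices (Ts ! i)"
  have "finite (?V \<inter> D)"
    using finite_verts verts_eq by auto
  then obtain d where d: "?V \<inter> D \<subseteq> {d}"
    using small by (metis One_nat_def card_le_Suc0_iff_eq empty_subsetI insertCI singletonD subsetI
        ex_in_conv)
  \<comment> \<open>If the class misses \<open>D\<close>, any of its elements will do: it lies in
    \<open>I\<close>, and the argument below then leaves no other vertex in
    \<open>I\<close>.\<close>
  define c where "c = (if ?V \<inter> D = {} then SOME v. v \<in> ?V else d)"
  have cV: "c \<in> ?V"
    using d class_nonempty[OF i] unfolding c_def by (auto simp: some_in_eq)
  have VD: "?V \<inter> D \<subseteq> {c}" using d unfolding c_def by auto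
  have "(x, c) \<in> parcs (Ts ! i)" if x: "x \<in> I" "x \<noteq> c" for x
  proof -
    obtain z where z: "z \<in> ?V" "(x, z) \<in> parcs (Ts ! i)"
      using internal_neighbour[OF i, of x c] x cV verts_eq by auto
    then have "z \<in> D" using neighbour_of_independent x(1) tree_arcs[OF i] by blast
    then show ?thesis using z VD by auto
  qed
  moreover have "?V \<subseteq> insert c I"
    using VD internal_vertices_verts[OF i] verts_eq by blast
  ultimately show ?thesis using that cV by blast
qed

text \<open>The centers of two small classes would be adjacent in both trees.\<close>

lemma small_class_unique:
  assumes i: "i < length Ts" "card (internal_vertices (Ts ! i) \<inter> D) \<le> 1"
    and j: "j < length Ts" "card (internal_vertices (Ts ! j) \<inter> D) \<le> 1"
  shows "i = j"
proof (rule ccontr)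
  assume ij: "i \<noteq> j"
  obtain c where c: "c \<in> internal_vertices (Ts ! i)" "internal_vertices (Ts ! i) \<subseteq> insert c I"
    "\<And>x. x \<in> I \<Longrightarrow> x \<noteq> c \<Longrightarrow> (x, c) \<in> parcs (Ts ! i)"
    using small_class_center i by blast
  obtain d where d: "d \<in> internal_vertices (Ts ! j)" "internal_vertices (Ts ! j) \<subseteq> insert d I"
    "\<And>x. x \<in> I \<Longrightarrow> x \<noteq> d \<Longrightarrow> (x, d) \<in> parcs (Ts ! j)"
    using small_class_center j by blast
  have disj: "internal_vertices (Ts ! i) \<inter> internal_vertices (Ts ! j) = {}"
    using internal_vertices_disjoint i(1) j(1) ij .
  have "(d, c) \<in> parcs (Ts ! i)"
  proof -
    obtain z where z: "z \<in> internal_vertices (Ts ! i)" "(d, z) \<in> parcs (Ts ! i)"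
      using internal_neighbour[OF i(1), of d c] c(1) d(1) disj internal_vertices_verts[OF j(1)]
      by blast
    have "z = c"
    proof (rule ccontr)
      assume "z \<noteq> c"
      \<comment> \<open>Being in \<open>I\<close>, \<open>z\<close> is joined to the center
        \<open>d\<close> in the \<open>j\<close>-th tree, so both trees contain the edge between
        \<open>d\<close> and \<open>z\<close>.\<close>
      then have "z \<in> I" "z \<noteq> d" using z c(2) d(1) disj by blast+
      then have "(z, d) \<in> parcs (Ts ! j)" using d(3) by blast
      then show False
        using arcs_disjoint[OF i(1) j(1) ij] tree_arc_sym i(1) z(2) by blast
    qed
    then show ?thesis using z by simp
  qed
  moreover have "(c, d) \<in> parcs (Ts ! j)"
  proof -
    obtain z where z: "z \<in> internal_vertices (Ts ! j)" "(c, z) \<in> parcs (Ts ! j)"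
      using internal_neighbour[OF j(1), of c d] c(1) d(1) disj internal_vertices_verts[OF i(1)]
      by blast
    have "z = d"
    proof (rule ccontr)
      assume "z \<noteq> d"
      then have "z \<in> I" "z \<noteq> c" using z d(2) c(1) disj by blast+
      then have "(z, c) \<in> parcs (Ts ! i)" using c(3) by blast
      then show False
        using arcs_disjoint[OF i(1) j(1) ij] tree_arc_sym j(1) z(2) by blast
    qed
    then show ?thesis using z by simp
  qed
  ultimately show False using arcs_disjoint[OF i(1) j(1) ij] tree_arc_sym j(1) by blast
qed

text \<open>The class has an element in \<open>D\<close>, hence one other than \<open>x\<close>, so
  \<open>x\<close> has a tree neighbour in the class; independence of \<open>I\<close> puts it into
  \<open>D\<close>.\<close>

lemma large_class_meets_neighbourhood:
  assumes i: "i < length Ts" and large: "\<not> card (internal_vertices (Ts ! i) \<inter> D) \<le> 1"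
    and x: "x \<in> I"
  shows "internal_vertices (Ts ! i) \<inter> D \<inter> neighbourhood G x \<noteq> {}"
proof -
  have "internal_vertices (Ts ! i) \<inter> D \<noteq> {}" using large by (intro notI) simp
  then obtain y where "y \<in> internal_vertices (Ts ! i)" "x \<noteq> y" using x D_I_disjoint by blast
  then obtain z where z: "z \<in> internal_vertices (Ts ! i)" "(x, z) \<in> parcs (Ts ! i)"
    using internal_neighbour[OF i, of x y] x verts_eq by blast
  then have "(x, z) \<in> parcs G" using tree_arcs[OF i] by blast
  then show ?thesis using z neighbour_of_independent[OF x] by (auto simp: neighbourhood_def)
qed

end

section \<open>Bipanchromatic coloring from the large classes\<close>

lemma bipanchromatic_coloring_of_classes:
  assumes "1 \<le> n" "finite I"
    and disj: "\<And>i j. i \<in> {1..n} \<Longrightarrow> j \<in> {1..n} \<Longrightarrow> i \<noteq> j \<Longrightarrow> W i \<inter> W j = {}"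
    and large: "\<And>i. i \<in> {1..n} \<Longrightarrow> 2 \<le> card (W i \<inter> D)"
    and meets: "\<And>i x. i \<in> {1..n} \<Longrightarrow> x \<in> I \<Longrightarrow> W i \<inter> D \<inter> neighbourhood G x \<noteq> {}"
    and "finite D"
  shows "\<exists>c. bipanchromatic_coloring (split_hypergraph G D I) n c"
proof -
  \<comment> \<open>Vertices outside all classes get the default color 1, which is a legal color
    because \<open>1 \<le> n\<close>; this can only enlarge a color class.\<close>
  define c where "c v = (if \<exists>i\<in>{1..n}. v \<in> W i then THE i. i \<in> {1..n} \<and> v \<in> W i else 1)" for v
  have c: "c v = i" if "i \<in> {1..n}" "v \<in> W i" for i v
  proof -
    have "(THE i. i \<in> {1..n} \<and> v \<in> W i) = i" using that disj by (intro the_equality) blast+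
    then show ?thesis unfolding c_def using that by auto
  qed
  have "c v \<in> {1..n}" for v
  proof (cases "\<exists>i\<in>{1..n}. v \<in> W i")
    case True then show ?thesis using c by metis
  next
    case False then show ?thesis using assms(1) unfolding c_def by auto
  qed
  moreover have "\<exists>v\<in>neighbourhood G x. c v = i" if "i \<in> {1..n}" "x \<in> I" for i x
    using meets[OF that] c[OF that(1)] by blast
  moreover have "2 \<le> card {v \<in> D. c v = i}" if i: "i \<in> {1..n}" for i
  proof -
    have "card (W i \<inter> D) \<le> card {v \<in> D. c v = i}"
      using c[OF i] \<open>finite D\<close> by (intro card_mono) auto
    then show ?thesis using large[OF i] by linarith
  qed
  ultimately have "bipanchromatic_coloring (split_hypergraph G D I) n c"
    using \<open>finite I\<close>
    by (auto simp: bipanchromatic_coloring_def panchromatic_coloring_def split_hypergraph_def)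
  then show ?thesis by blast
qed

theorem theorem7:
  fixes G :: "'a pair_pre_digraph" and D I :: "'a set" and k :: nat
  assumes "split_graph G D I"
    and "\<forall>v\<in>D. \<exists>x\<in>I. (v, x) \<in> parcs G"
    and "card (pverts G) \<noteq> 1"
    and "k = bipanchromatic_number (split_hypergraph G D I)"
  shows "\<not> (\<exists>Ts. length Ts = k + 2 \<and> completely_independent_spanning_trees G Ts)"
proof
  assume "\<exists>Ts. length Ts = k + 2 \<and> completely_independent_spanning_trees G Ts"
  then obtain Ts where len: "length Ts = k + 2" and "completely_independent_spanning_trees G Ts"
    by blast
  then interpret split_independent_trees G Ts D I
    using assms(1,3) by unfold_locales auto
  define small where "small i \<longleftrightarrow> card (internal_vertices (Ts ! i) \<inter> D) \<le> 1" for i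
  \<comment> \<open>\<open>t\<close> is the index of the small class if there is one, and arbitrary
    otherwise. Giving up one index in any case leaves enough trees for \<open>k + 1\<close>
    colors.\<close>
  obtain t where t: "\<And>i. i < k + 2 \<Longrightarrow> small i \<Longrightarrow> i = t"
    using small_class_unique len unfolding small_def by metis
  \<comment> \<open>\<open>s\<close> maps \<open>{1..k + 1}\<close> injectively into the tree indices other than \<open>t\<close>.\<close>
  define s where "s i = (if i \<le> t then i - 1 else i)" for i
  have s: "s i < length Ts" "\<not> small (s i)" if "i \<in> {1..k + 1}" for i
    using that t[of "s i"] len unfolding s_def by (auto split: if_splits)
  have inj: "s i \<noteq> s j" if "i \<in> {1..k + 1}" "j \<in> {1..k + 1}" "i \<noteq> j" for i j
    using that unfolding s_def by auto
  have fin: "finite D" "finite I" using finite_verts verts_eq by auto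
  have "\<exists>c. bipanchromatic_coloring (split_hypergraph G D I) (k + 1) c"
  proof (rule bipanchromatic_coloring_of_classes[where W = "\<lambda>i. internal_vertices (Ts ! s i)"])
    show "2 \<le> card (internal_vertices (Ts ! s i) \<inter> D)" if "i \<in> {1..k + 1}" for i
      using s(2)[OF that] unfolding small_def by linarith
    show "internal_vertices (Ts ! s i) \<inter> internal_vertices (Ts ! s j) = {}"
      if "i \<in> {1..k + 1}" "j \<in> {1..k + 1}" "i \<noteq> j" for i j
      using internal_vertices_disjoint s(1) inj that by blast
    show "internal_vertices (Ts ! s i) \<inter> D \<inter> neighbourhood G x \<noteq> {}"
      if "i \<in> {1..k + 1}" "x \<in> I" for i x
      using large_class_meets_neighbourhood s that unfolding small_def by blast
  qed (use fin in auto)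
  then have "k + 1 \<le> bipanchromatic_number (split_hypergraph G D I)"
    using bipanchromatic_number_is_maximum(2)[of "split_hypergraph G D I"] fin(1)
    by (auto simp: split_hypergraph_def)
  then show False using assms(4) by simp
qed

end
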